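(* Let $\lambda$ be a nonzero real number and let $f(x)\in\mathbb{C}[\![x]\!]$. Then $$\sum_{n=0}^{\infty}H_{n,\lambda}\bigg(\sum_{m=0}^{\infty}\frac{f^{(m)}(0)}{m!}(n)_{m,\lambda}\bigg)x^{n}=\frac{1}{1-x}\sum_{m=0}^{\infty}\frac{f^{(m)}(0)}{m!}HF_{m,\lambda}\Big(\frac{x}{1-x}\Big)-\frac{\log_{\lambda}(1-x)}{1-x}\sum_{m=0}^{\infty}\frac{f^{(m)}(0)}{m!}F_{m,\lambda}^{(1-\lambda)}\Big(\frac{x}{1-x}\Big).$$
   Context: Fix a nonzero real $\lambda$. For $f(x)=\sum_{m\ge 0}a_mx^m\in\mathbb{C}[\![x]\!]$, $\frac{f^{(m)}(0)}{m!}$ denotes $a_m$. Notation: $(x)_{0,\lambda}=1$ and $(x)_{n,\lambda}=x(x-\lambda)\cdots(x-(n-1)\lambda)$ for $n\ge1$. Degenerate logarithm: $\log_{\lambda}(1+t)=\frac{1}{\lambda}\big((1+t)^{\lambda}-1\big)$, expanded as a power series in $t$. Degenerate exponential: $e_{\lambda}(t)=(1+\lambda t)^{1/\lambda}=\sum_{n\ge0}(1)_{n,\lambda}\frac{t^{n}}{n!}$. Degenerate harmonic numbers $H_{n,\lambda}$: $H_{0,\lambda}=0$ and $-\frac{\log_{\lambda}(1-t)}{1-t}=\sum_{n=1}^{\infty}H_{n,\lambda}t^{n}$. Degenerate harmonic-Fubini polynomials $HF_{n,\lambda}(x)$: defined by $$-\frac{\log_{\lambda}\big(1-x(e_{\lambda}(t)-1)\big)}{1-x(e_{\lambda}(t)-1)}=\sum_{n=1}^{\infty}HF_{n,\lambda}(x)\frac{t^{n}}{n!};$$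 this series has no constant term in $t$, so $HF_{0,\lambda}(x)=0$. For $\alpha\in\mathbb{R}$, the degenerate Fubini polynomials of order $\alpha$, $F_{n,\lambda}^{(\alpha)}(x)$, are defined by $$\bigg(\frac{1}{1-x(e_{\lambda}(t)-1)}\bigg)^{\alpha}=\sum_{n=0}^{\infty}F_{n,\lambda}^{(\alpha)}(x)\frac{t^{n}}{n!}.$$
   Formalization: The series f is assumed to be such that each inner sum over m of f^(m)(0)/m! (n)_{m,λ} converges (it diverges e.g. for λ=-1, n=1, all coefficients 1); sums over m on the right are taken coefficientwise in x, and their convergence is proved. *)

theory Defs
  imports
    Complex_Main
    "HOL-Computational_Algebra.Formal_Power_Series"
    "HOL-Computational_Algebra.Polynomial_FPS"
begin

definition degen_ffact :: "'a::comm_ring_1 \<Rightarrow> 'a \<Rightarrow> nat \<Rightarrow> 'a" where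
  "degen_ffact l x n = (\<Prod>i<n. x - of_nat i * l)"

text \<open>The power series \<open>log\<^sub>\<lambda>(1 + t)\<close> in \<open>t\<close>; it is evaluated at \<open>1 + u\<close>
  by composing with \<open>u\<close>.\<close>

definition degen_log :: "'a::field_char_0 \<Rightarrow> 'a fps" where
  "degen_log l = fps_const (1 / l) * (fps_binomial l - 1)"

definition degen_exp :: "'a::field_char_0 \<Rightarrow> 'a fps" where
  "degen_exp l = Abs_fps (\<lambda>n. degen_ffact l 1 n / fact n)"

lemma degen_exp_eq_binomial:
  assumes "l \<noteq> 0"
  shows "degen_exp l = fps_binomial (1 / l) oo (fps_const l * fps_X)"
proof (rule fps_ext)
  fix n
  have "degen_ffact l 1 n = l ^ n * (\<Prod>i<n. 1 / l - of_nat i)"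
    using assms unfolding degen_ffact_def
    by (induction n) (simp_all add: field_simps)
  then show "fps_nth (degen_exp l) n = fps_nth (fps_binomial (1 / l) oo (fps_const l * fps_X)) n"
    by (simp add: degen_exp_def gbinomial_prod_rev fps_compose_linear atLeast0LessThan)
qed

definition degen_harmonic :: "'a::field_char_0 \<Rightarrow> nat \<Rightarrow> 'a" where
  "degen_harmonic l n = fps_nth (- (degen_log l oo (- fps_X)) / (1 - fps_X)) n"

text \<open>
  The generating functions of the two polynomial families live in \<open>K[x][[t]]\<close>, i.e. in
  \<^typ>\<open>'a poly fps\<close>: the polynomial variable is \<open>x\<close> and the power series variable is \<open>t\<close>.
  A series \<open>g\<close> over \<open>K\<close> is evaluated at \<open>u\<close> in \<open>K[x][[t]]\<close> (with \<open>u\<close> having zero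
  constant term in \<open>t\<close>) by regarding its coefficients as constant polynomials.
\<close>

definition fps_eval_poly :: "'a::comm_ring_1 fps \<Rightarrow> 'a poly fps \<Rightarrow> 'a poly fps" where
  "fps_eval_poly g u = Abs_fps (\<lambda>n. [:fps_nth g n:]) oo u"

text \<open>The series \<open>x (e\<^sub>\<lambda>(t) - 1)\<close>.\<close>

definition fubini_arg :: "'a::field_char_0 \<Rightarrow> 'a poly fps" where
  "fubini_arg l = Abs_fps (\<lambda>n. monom (fps_nth (degen_exp l - 1) n) 1)"

text \<open>The series \<open>1 / (1 - x (e\<^sub>\<lambda>(t) - 1))\<close>. Since \<open>K[x]\<close> is not a field, the inverse is
  taken with \<open>fps_right_inverse\<close>, whose second argument is the inverse of the
  constant term.\<close>

definition fubini_inv :: "'a::field_char_0 \<Rightarrow> 'a poly fps" where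
  "fubini_inv l = fps_right_inverse (1 - fubini_arg l) 1"

lemma fubini_inv_mult: "(1 - fubini_arg l) * fubini_inv l = 1"
  unfolding fubini_inv_def
  by (rule fps_right_inverse) (simp add: fubini_arg_def degen_exp_def degen_ffact_def)

definition harmonic_fubini :: "'a::field_char_0 \<Rightarrow> nat \<Rightarrow> 'a poly" where
  "harmonic_fubini l n =
     smult (fact n) (fps_nth (- fps_eval_poly (degen_log l) (- fubini_arg l) * fubini_inv l) n)"

text \<open>A series \<open>w\<close> with constant term \<open>1\<close> is raised to the power \<open>\<alpha>\<close> by the binomial series
  \<open>(1 + u)\<^sup>\<alpha>\<close> at \<open>u = w - 1\<close>.\<close>

definition degen_fubini :: "'a::field_char_0 \<Rightarrow> 'a \<Rightarrow> nat \<Rightarrow> 'a poly" where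
  "degen_fubini \<alpha> l n =
     smult (fact n) (fps_nth (fps_eval_poly (fps_binomial \<alpha>) (fubini_inv l - 1)) n)"

text \<open>
  The coefficientwise sum of a sequence of complex power series. The topology that the
  library puts on \<^typ>\<open>complex fps\<close> is the \<open>X\<close>-adic one, in which the coefficients carry
  the discrete topology; here each coefficient is summed as a series of complex numbers.
\<close>

definition fps_coeff_summable :: "(nat \<Rightarrow> complex fps) \<Rightarrow> bool" where
  "fps_coeff_summable g \<longleftrightarrow> (\<forall>k. summable (\<lambda>m. fps_nth (g m) k))"

definition fps_coeff_suminf :: "(nat \<Rightarrow> complex fps) \<Rightarrow> complex fps" where
  "fps_coeff_suminf g = Abs_fps (\<lambda>k. \<Sum>m. fps_nth (g m) k)"

text \<open>The polynomial \<open>p\<close> evaluated at the power series \<open>x / (1 - x)\<close>.\<close>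

definition poly_at_ratio :: "complex poly \<Rightarrow> complex fps" where
  "poly_at_ratio p = fps_of_poly p oo (fps_X / (1 - fps_X))"

end

theory Submission
  imports Defs
begin

text \<open>
  Everything reduces to powers of \<open>1 - x\<close>. Write \<open>(j)\<^sub>m\<close> for the degenerate falling factorial
  \<open>j (j - \<lambda>) \<dots> (j - (m - 1) \<lambda>)\<close> and \<open>b\<^sub>n(\<alpha>)\<close> for the coefficients of
  \<open>(1 - x)\<^bsup>-\<alpha>\<^esup>\<close>. Because \<open>log\<^sub>\<lambda>(1 - u) = ((1 - u)\<^sup>\<lambda> - 1) / \<lambda>\<close>, the series behind the harmonic
  objects is a difference of two powers,
  \<open>- log\<^sub>\<lambda>(1 - u) / (1 - u) = ((1 - u)\<^bsup>-1\<^esup> - (1 - u)\<^bsup>-(1-\<lambda>)\<^esup>) / \<lambda>\<close>. Hence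
  \<open>H\<^sub>n = (b\<^sub>n(1) - b\<^sub>n(1 - \<lambda>)) / \<lambda>\<close>, and the harmonic-Fubini polynomials are
  \<open>1 / \<lambda>\<close> times the difference of the Fubini polynomials of orders \<open>1\<close> and \<open>1 - \<lambda>\<close>
  (\<open>degen_harmonic_eq\<close>, \<open>harmonic_fubini_eq\<close>).

  The heart of the proof is the identity (\<open>poly_at_ratio_degen_fubini\<close>)
  \<open>F\<^sub>m(x / (1 - x)) = (1 - x)\<^sup>\<alpha> (\<Sum>j. b\<^sub>j(\<alpha>) (j)\<^sub>m x\<^sup>j)\<close> for the Fubini polynomial \<open>F\<^sub>m\<close> of order \<open>\<alpha>\<close>.
  It reflects the factorization
  \<open>1 - x e\<^sub>\<lambda>(t) = (1 - x) (1 - y (e\<^sub>\<lambda>(t) - 1))\<close> with \<open>y = x / (1 - x)\<close>: raise both sides to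
  the power \<open>-\<alpha>\<close> and compare coefficients of \<open>t\<^sup>m / m!\<close>, using that those of \<open>e\<^sub>\<lambda>(t)\<^sup>j\<close> are the
  numbers \<open>(j)\<^sub>m\<close>. As \<open>x e\<^sub>\<lambda>(t)\<close> has the constant term \<open>x\<close> in \<open>t\<close>, the left side
  raised to \<open>-\<alpha>\<close> is no composition of power series in \<open>t\<close>; the proof therefore stays on the right, expands
  \<open>(e\<^sub>\<lambda>(t) - 1)\<^sup>i\<close> binomially and sums over \<open>i\<close> in closed form for each \<open>j\<close>.

  The identity also settles convergence: each coefficient in \<open>x\<close> of the right side is a finite
  combination, with weights that do not depend on \<open>m\<close>, of the numbers \<open>(j)\<^sub>m\<close>. Multiplying by the
  coefficients of \<open>f\<close> and summing over \<open>m\<close> is therefore legitimate as soon as the sums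
  \<open>S\<^sub>j = \<Sum>m. f\<^sub>m (j)\<^sub>m\<close> exist, and it replaces \<open>(j)\<^sub>m\<close> by \<open>S\<^sub>j\<close>. With \<open>A(\<alpha>) = \<Sum>n. b\<^sub>n(\<alpha>) S\<^sub>n x\<^sup>n\<close>,
  the two sums on the right of the theorem are
  \<open>((1 - x) A(1) - (1 - x)\<^bsup>1-\<lambda>\<^esup> A(1 - \<lambda>)) / \<lambda>\<close> and \<open>(1 - x)\<^bsup>1-\<lambda>\<^esup> A(1 - \<lambda>)\<close>, and the whole
  right side collapses to \<open>(A(1) - A(1 - \<lambda>)) / \<lambda>\<close>, which is the left side.
\<close>

section \<open>Powers of \<open>1 - x\<close>\<close>

definition one_minus_X_powr :: "'a::field_char_0 \<Rightarrow> 'a fps" where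
  "one_minus_X_powr a = fps_binomial a oo (- fps_X)"

lemma one_minus_X_powr_nth: "fps_nth (one_minus_X_powr a) n = (-1) ^ n * (a gchoose n)"
  by (simp add: one_minus_X_powr_def fps_compose_uminus')

lemma one_minus_X_powr_add:
  "one_minus_X_powr (a + b) = one_minus_X_powr a * one_minus_X_powr b"
  by (simp add: one_minus_X_powr_def fps_binomial_add_mult fps_compose_mult_distrib)

lemma one_minus_X_powr_0: "one_minus_X_powr 0 = 1"
  by (simp add: one_minus_X_powr_def)

lemma one_minus_X_powr_of_nat: "one_minus_X_powr (of_nat n) = (1 - fps_X) ^ n"
  by (simp add: one_minus_X_powr_def fps_binomial_of_nat fps_compose_power [symmetric]
      fps_compose_add_distrib)

lemma one_minus_X_powr_minus_one: "one_minus_X_powr (-1) = inverse (1 - fps_X)"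
proof -
  have "(1 - fps_X) * one_minus_X_powr (-1) = (1 :: 'a fps)"
    using one_minus_X_powr_add [of "1 :: 'a" "-1"] one_minus_X_powr_of_nat [of 1, where ?'a = 'a]
    by (simp add: one_minus_X_powr_0)
  then show ?thesis
    by (metis fps_inverse_unique)
qed

abbreviation ratio :: "'a::field_char_0 fps" where
  "ratio \<equiv> fps_X / (1 - fps_X)"

lemma ratio_altdef: "(ratio :: 'a::field_char_0 fps) = inverse (1 - fps_X) - 1"
  and ratio_mult_one_minus_X: "(ratio :: 'a::field_char_0 fps) * (1 - fps_X) = fps_X"
proof -
  have *: "inverse (1 - fps_X) * (1 - fps_X) = (1 :: 'a fps)"
    by (rule inverse_mult_eq_1) simp
  have r: "ratio = fps_X * inverse (1 - fps_X :: 'a fps)"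
    by (simp add: fps_divide_unit)
  show "(ratio :: 'a fps) = inverse (1 - fps_X) - 1"
    using * unfolding r by (simp add: algebra_simps)
  show "(ratio :: 'a fps) * (1 - fps_X) = fps_X"
    using * unfolding r by (simp add: mult.assoc)
qed

lemma ratio_nth_0: "fps_nth (ratio :: 'a::field_char_0 fps) 0 = 0"
  by (simp add: ratio_altdef)

text \<open>
  Since \<open>1 + x / (1 - x) = (1 - x)\<^bsup>-1\<^esup>\<close>, this is the power law \<open>((1 - x)\<^bsup>-1\<^esup>)\<^sup>a = (1 - x)\<^bsup>-a\<^esup>\<close>.
  For a general exponent a power is a binomial series, so the law is derived from the differential
  equation that characterizes those series. That equation is stated for powers of \<open>1 + x\<close>; hence
  \<open>x\<close> is first replaced by \<open>-x\<close>.
\<close>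

lemma fps_binomial_compose_ratio:
  "fps_binomial a oo ratio = one_minus_X_powr (- a :: 'a::field_char_0)"
proof -
  define w :: "'a fps" where "w = ratio oo (- fps_X)"
  have w: "w = inverse (1 + fps_X) - 1"
    by (simp add: w_def ratio_altdef fps_compose_sub_distrib fps_inverse_compose)
  have inv: "inverse (1 + fps_X) * (1 + fps_X) = (1 :: 'a fps)"
    by (rule inverse_mult_eq_1) simp
  have w0: "fps_nth w 0 = 0"
    by (simp add: w)
  define h where "h = fps_binomial a oo w"
  have "fps_deriv h = ((fps_const a * fps_binomial a * inverse (1 + fps_X)) oo w) * fps_deriv w"
    unfolding h_def
    by (simp add: fps_compose_deriv [OF w0] fps_binomial_deriv fps_divide_unit)
  also have "\<dots> = fps_const a * h * inverse (1 + w) * fps_deriv w"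
    by (simp add: fps_compose_mult_distrib [OF w0] fps_inverse_compose [OF w0] h_def w0
        fps_compose_add_distrib)
  also have "inverse (1 + w) = 1 + fps_X"
    by (simp add: w)
  also have "fps_deriv w = - (inverse (1 + fps_X) * inverse (1 + fps_X))"
    by (simp add: w fps_inverse_deriv power2_eq_square)
  also have "fps_const a * h * (1 + fps_X) * - (inverse (1 + fps_X) * inverse (1 + fps_X))
      = - (fps_const a * h * inverse (1 + fps_X)) * (inverse (1 + fps_X) * (1 + fps_X))"
    by (simp add: algebra_simps)
  also have "\<dots> = fps_const (- a) * h / (1 + fps_X)"
    by (simp only: inv) (simp add: fps_divide_unit fps_const_neg [symmetric] del: fps_const_neg)
  finally have "h = fps_binomial (- a)"
    by (subst fps_binomial_ODE_unique' [symmetric]) (simp add: h_def)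
  then have "one_minus_X_powr (- a) = fps_binomial a oo (ratio oo (- fps_X)) oo (- fps_X)"
    by (simp add: one_minus_X_powr_def h_def w_def)
  also have "\<dots> = fps_binomial a oo (ratio oo ((- fps_X) oo (- fps_X)))"
    by (simp add: fps_compose_assoc [symmetric] ratio_nth_0)
  also have "(- fps_X) oo (- fps_X) = (fps_X :: 'a fps)"
    by (simp add: fps_compose_uminus)
  finally show ?thesis
    by simp
qed

section \<open>Generating functions over the polynomial ring\<close>

text \<open>
  The embedding of \<open>K[[t]]\<close> into \<open>K[x][[t]]\<close>. It is a ring homomorphism that respects composition,
  so evaluation at a series \<open>u\<close> over \<open>K[x]\<close> does too, and identities between generating functions
  can be proved in one variable over the field.
\<close>

definition fps_of_coeffs :: "'a::comm_ring_1 fps \<Rightarrow> 'a poly fps" where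
  "fps_of_coeffs g = Abs_fps (\<lambda>n. [:fps_nth g n:])"

lemma fps_of_coeffs_nth [simp]: "fps_nth (fps_of_coeffs g) n = [:fps_nth g n:]"
  by (simp add: fps_of_coeffs_def)

lemma const_poly_sum: "[:sum f A:] = (\<Sum>i\<in>A. [:f i:])"
  by (rule poly_eqI) (simp add: coeff_sum coeff_pCons split: nat.split)

lemma fps_of_coeffs_mult: "fps_of_coeffs (f * g) = fps_of_coeffs f * fps_of_coeffs g"
  by (rule fps_ext) (simp add: fps_mult_nth const_poly_sum mult.commute)

lemma fps_of_coeffs_1 [simp]: "fps_of_coeffs 1 = 1"
  by (rule fps_ext) (simp add: one_pCons)

lemma fps_of_coeffs_diff: "fps_of_coeffs (f - g) = fps_of_coeffs f - fps_of_coeffs g"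
  by (rule fps_ext) simp

lemma fps_of_coeffs_uminus: "fps_of_coeffs (- f) = - fps_of_coeffs f"
  by (rule fps_ext) simp

lemma fps_of_coeffs_X [simp]: "fps_of_coeffs fps_X = fps_X"
  by (rule fps_ext) (simp add: one_pCons)

lemma fps_of_coeffs_power: "fps_of_coeffs (f ^ n) = fps_of_coeffs f ^ n"
  by (induction n) (simp_all add: fps_of_coeffs_mult)

lemma fps_of_coeffs_compose: "fps_of_coeffs (f oo g) = fps_of_coeffs f oo fps_of_coeffs g"
  by (rule fps_ext)
    (simp add: fps_compose_nth const_poly_sum mult.commute flip: fps_of_coeffs_power)

lemma fps_eval_poly_altdef: "fps_eval_poly g u = fps_of_coeffs g oo u"
  by (simp add: fps_eval_poly_def fps_of_coeffs_def)

lemma fps_eval_poly_mult: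
  fixes f g :: "'a::idom fps"
  assumes "fps_nth u 0 = 0"
  shows "fps_eval_poly (f * g) u = fps_eval_poly f u * fps_eval_poly g u"
  using assms by (simp add: fps_eval_poly_altdef fps_of_coeffs_mult fps_compose_mult_distrib)

lemma fps_eval_poly_1: "fps_eval_poly 1 u = 1"
  by (simp add: fps_eval_poly_altdef)

lemma fps_eval_poly_diff: "fps_eval_poly (f - g) u = fps_eval_poly f u - fps_eval_poly g u"
  by (simp add: fps_eval_poly_altdef fps_of_coeffs_diff fps_compose_sub_distrib)

lemma fps_eval_poly_uminus: "fps_eval_poly (- f) u = - fps_eval_poly f u"
  by (simp add: fps_eval_poly_altdef fps_of_coeffs_uminus fps_compose_uminus)

lemma fps_eval_poly_X:
  assumes "fps_nth u 0 = 0"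
  shows "fps_eval_poly fps_X u = u"
  using assms by (simp add: fps_eval_poly_altdef)

lemma fps_eval_poly_compose:
  fixes f g :: "'a::idom fps"
  assumes "fps_nth u 0 = 0" "fps_nth g 0 = 0"
  shows "fps_eval_poly (f oo g) u = fps_eval_poly f (fps_eval_poly g u)"
  using assms by (simp add: fps_eval_poly_altdef fps_of_coeffs_compose fps_compose_assoc)

lemma fubini_arg_nth_0: "fps_nth (fubini_arg l) 0 = 0"
  by (simp add: fubini_arg_def degen_exp_def degen_ffact_def)

lemma fubini_inv_altdef: "fubini_inv l = fps_eval_poly (inverse (1 - fps_X)) (fubini_arg l)"
proof -
  have "(1 - fubini_arg l) * fps_eval_poly (inverse (1 - fps_X)) (fubini_arg l)
      = fps_eval_poly ((1 - fps_X) * inverse (1 - fps_X)) (fubini_arg l)"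
    by (simp only: fps_eval_poly_mult [OF fubini_arg_nth_0] fps_eval_poly_diff fps_eval_poly_1
        fps_eval_poly_X [OF fubini_arg_nth_0])
  also have "(1 - fps_X) * inverse (1 - fps_X) = (1 :: 'a fps)"
    by (rule inverse_mult_eq_1') simp
  finally have *: "(1 - fubini_arg l) * fps_eval_poly (inverse (1 - fps_X)) (fubini_arg l) = 1"
    by (simp add: fps_eval_poly_1)
  have "fubini_inv l = fubini_inv l * ((1 - fubini_arg l)
      * fps_eval_poly (inverse (1 - fps_X)) (fubini_arg l))"
    by (simp add: *)
  also have "\<dots> = ((1 - fubini_arg l) * fubini_inv l)
      * fps_eval_poly (inverse (1 - fps_X)) (fubini_arg l)"
    by (simp only: mult_ac)
  finally show ?thesis
    by (simp add: fubini_inv_mult)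
qed

text \<open>
  The defining series is a power of \<open>w = (1 - u)\<^bsup>-1\<^esup>\<close>, expanded around \<open>w = 1\<close>. As
  \<open>w - 1 = u / (1 - u)\<close>, the power law above rewrites it as a series in \<open>u = x (e\<^sub>\<lambda>(t) - 1)\<close>
  itself.
\<close>

lemma degen_fubini_altdef:
  "degen_fubini a l n
     = smult (fact n) (fps_nth (fps_eval_poly (one_minus_X_powr (- a)) (fubini_arg l)) n)"
proof -
  have "fubini_inv l - 1 = fps_eval_poly ratio (fubini_arg l)"
    by (simp add: fubini_inv_altdef ratio_altdef fps_eval_poly_diff fps_eval_poly_1)
  then have "fps_eval_poly (fps_binomial a) (fubini_inv l - 1)
      = fps_eval_poly (fps_binomial a oo ratio) (fubini_arg l)"
    by (simp add: fps_eval_poly_compose fubini_arg_nth_0 ratio_nth_0)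
  then show ?thesis
    by (simp add: degen_fubini_def fps_binomial_compose_ratio)
qed

section \<open>The logarithm as a difference of two powers\<close>

lemma degen_log_compose_uminus_X:
  "degen_log l oo (- fps_X) = fps_const (1 / l) * (one_minus_X_powr l - 1)"
  by (simp add: degen_log_def one_minus_X_powr_def fps_compose_mult_distrib
      fps_compose_sub_distrib)

lemma harmonic_gf:
  "- (degen_log l oo (- fps_X)) * inverse (1 - fps_X)
     = fps_const (1 / l) * (one_minus_X_powr (- 1) - one_minus_X_powr (- (1 - l)))"
proof -
  have "one_minus_X_powr (- (1 - l)) = one_minus_X_powr l * inverse (1 - fps_X)"
    using one_minus_X_powr_add [of l "-1"] by (simp add: one_minus_X_powr_minus_one)
  then show ?thesis
    by (simp add: degen_log_compose_uminus_X one_minus_X_powr_minus_one algebra_simps)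
qed

lemma degen_harmonic_eq:
  "degen_harmonic l n
     = (fps_nth (one_minus_X_powr (- 1)) n - fps_nth (one_minus_X_powr (- (1 - l))) n) / l"
proof -
  have "- (degen_log l oo (- fps_X)) / (1 - fps_X)
      = - (degen_log l oo (- fps_X)) * inverse (1 - fps_X)"
    by (rule fps_divide_unit) simp
  then show ?thesis
    by (simp only: degen_harmonic_def harmonic_gf) simp
qed

lemma harmonic_fubini_eq:
  "harmonic_fubini l n = smult (1 / l) (degen_fubini 1 l n - degen_fubini (1 - l) l n)"
proof -
  define u where "u = fubini_arg l"
  have u0: "fps_nth u 0 = 0"
    by (simp add: u_def fubini_arg_nth_0)
  have "- fps_eval_poly (degen_log l) (- u) * fubini_inv l
      = fps_eval_poly (- (degen_log l oo (- fps_X)) * inverse (1 - fps_X)) u"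
    using u0
    by (simp add: fps_eval_poly_mult fps_eval_poly_uminus fps_eval_poly_compose fps_eval_poly_X
        fubini_inv_altdef flip: u_def)
  also have "\<dots> = fps_eval_poly (fps_const (1 / l)) u
      * (fps_eval_poly (one_minus_X_powr (- 1)) u - fps_eval_poly (one_minus_X_powr (- (1 - l))) u)"
    by (simp only: harmonic_gf fps_eval_poly_mult [OF u0] fps_eval_poly_diff)
  also have "fps_eval_poly (fps_const (1 / l)) u = fps_const [:1 / l:]"
  proof -
    have "fps_of_coeffs (fps_const (1 / l)) = fps_const [:1 / l:]"
      by (rule fps_ext) simp
    then show ?thesis
      by (simp add: fps_eval_poly_altdef)
  qed
  finally show ?thesis
    by (simp add: harmonic_fubini_def degen_fubini_altdef u_def smult_diff_right mult.commute)
qed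

section \<open>The Fubini polynomials at \<open>x / (1 - x)\<close>\<close>

text \<open>
  By \<open>e\<^sub>\<lambda>(t)\<^sup>j = (1 + \<lambda> t)\<^bsup>j/\<lambda>\<^esup>\<close>, taking a power only changes the upper index of the binomial series.
\<close>

lemma degen_exp_power_nth:
  assumes "l \<noteq> 0"
  shows "fact m * fps_nth (degen_exp l ^ j) m = degen_ffact l (of_nat j) m"
proof -
  have "degen_exp l ^ j = fps_binomial (of_nat j * (1 / l)) oo (fps_const l * fps_X)"
    by (simp add: degen_exp_eq_binomial [OF assms] fps_compose_power fps_binomial_power)
  then have "fact m * fps_nth (degen_exp l ^ j) m = l ^ m * (\<Prod>i<m. of_nat j / l - of_nat i)"
    by (simp add: gbinomial_prod_rev atLeast0LessThan)
  also have "\<dots> = degen_ffact l (of_nat j) m"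
    using assms unfolding degen_ffact_def by (induction m) (simp_all add: field_simps)
  finally show ?thesis .
qed

lemma degen_exp_minus_one_power_nth:
  assumes "l \<noteq> 0"
  shows "fact m * fps_nth ((degen_exp l - 1) ^ i) m
    = (\<Sum>j\<le>i. of_nat (i choose j) * (-1) ^ (i - j) * degen_ffact l (of_nat j) m)"
proof -
  have "(degen_exp l - 1) ^ i
      = (\<Sum>j\<le>i. fps_const (of_nat (i choose j) * (-1) ^ (i - j)) * degen_exp l ^ j)"
    using binomial_ring [of "degen_exp l" "-1" i]
    by (simp add: mult_ac fps_of_nat flip: fps_const_mult fps_const_power fps_const_neg)
  then have "fact m * fps_nth ((degen_exp l - 1) ^ i) m
      = (\<Sum>j\<le>i. of_nat (i choose j) * (-1) ^ (i - j) * (fact m * fps_nth (degen_exp l ^ j) m))"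
    by (simp add: fps_sum_nth sum_distrib_left mult_ac)
  then show ?thesis
    by (simp add: degen_exp_power_nth [OF assms])
qed

lemma fubini_arg_power_nth:
  "fps_nth (fubini_arg l ^ i) n = monom (fps_nth ((degen_exp l - 1) ^ i) n) i"
proof (induction i arbitrary: n)
  case 0
  then show ?case by (simp add: monom_0 one_pCons)
next
  case (Suc i)
  have "fps_nth (fubini_arg l ^ Suc i) n
      = (\<Sum>k=0..n. monom (fps_nth (degen_exp l - 1) k * fps_nth ((degen_exp l - 1) ^ i) (n - k)) (Suc i))"
    by (simp add: fps_mult_nth Suc.IH mult_monom fubini_arg_def [THEN arg_cong, of "\<lambda>h. fps_nth h _"])
  also have "\<dots> = monom (fps_nth ((degen_exp l - 1) ^ Suc i) n) (Suc i)"
    by (simp add: fps_mult_nth monom_sum)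
  finally show ?case .
qed

lemma poly_at_ratio_diff: "poly_at_ratio (p - q) = poly_at_ratio p - poly_at_ratio q"
  by (simp add: poly_at_ratio_def fps_of_poly_diff fps_compose_sub_distrib)

lemma poly_at_ratio_smult: "poly_at_ratio (smult c p) = fps_const c * poly_at_ratio p"
  by (simp add: poly_at_ratio_def fps_of_poly_smult fps_compose_mult_distrib ratio_nth_0)

lemma poly_at_ratio_sum: "poly_at_ratio (sum p A) = (\<Sum>i\<in>A. poly_at_ratio (p i))"
  by (simp add: poly_at_ratio_def fps_of_poly_sum fps_compose_sum_distrib)

lemma poly_at_ratio_monom: "poly_at_ratio (monom c i) = fps_const c * ratio ^ i"
  by (simp add: poly_at_ratio_def fps_of_poly_monom fps_compose_mult_distrib ratio_nth_0
      flip: fps_compose_power)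

text \<open>
  The \<open>i\<close>th term of the composition has order at least \<open>i\<close> in \<open>t\<close> and, after the substitution of
  \<open>x / (1 - x)\<close>, also in \<open>x\<close>. The natural cutoff \<open>i \<le> m\<close> coming from the power of \<open>t\<close> can thus be
  traded for \<open>i \<le> k\<close>, a bound that does not depend on \<open>m\<close>.
\<close>

lemma poly_at_ratio_eval_fubini_arg_nth:
  "fps_nth (poly_at_ratio (fps_nth (fps_eval_poly g (fubini_arg l)) m)) k
     = (\<Sum>i\<le>k. fps_nth g i * fps_nth ((degen_exp l - 1) ^ i) m * fps_nth (ratio ^ i) k)"
    (is "_ = (\<Sum>i\<le>k. ?t i)")
proof -
  have e0: "fps_nth (degen_exp l - 1) 0 = 0"
    by (simp add: degen_exp_def degen_ffact_def)
  have "fps_nth (poly_at_ratio (fps_nth (fps_eval_poly g (fubini_arg l)) m)) k = (\<Sum>i\<le>m. ?t i)"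
    by (simp add: fps_eval_poly_altdef fps_compose_nth fubini_arg_power_nth poly_at_ratio_sum
        poly_at_ratio_smult poly_at_ratio_monom fps_sum_nth atLeast0AtMost mult.assoc)
  also have "\<dots> = (\<Sum>i\<le>max m k. ?t i)"
    by (rule sum.mono_neutral_left) (auto simp: startsby_zero_power_prefix [OF e0])
  also have "\<dots> = (\<Sum>i\<le>k. ?t i)"
    by (rule sum.mono_neutral_right) (auto simp: startsby_zero_power_prefix [OF ratio_nth_0])
  finally show ?thesis .
qed

text \<open>
  Trinomial revision of binomial coefficients, with the signs of the expansions of \<open>(1 - x)\<^sup>a\<close>
  and \<open>(e - 1)\<^sup>i\<close> absorbed.
\<close>

lemma one_minus_X_powr_nth_revision:
  assumes "j \<le> i"
  shows "fps_nth (one_minus_X_powr a) i * (of_nat (i choose j) * (-1) ^ (i - j))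
    = fps_nth (one_minus_X_powr a) j * (a - of_nat j gchoose (i - j))"
proof -
  obtain d where i: "i = j + d"
    using assms le_Suc_ex by blast
  have "fps_nth (one_minus_X_powr a) i * (of_nat (i choose j) * (-1) ^ (i - j))
      = ((-1) ^ d * (-1) ^ d) * (-1) ^ j * ((a gchoose i) * (of_nat i gchoose j))"
    by (simp only: i one_minus_X_powr_nth power_add binomial_gbinomial mult_ac add_diff_cancel_left')
  also have "(-1) ^ d * (-1) ^ d = (1 :: 'a)"
    by (rule minus_one_mult_self)
  finally show ?thesis
    by (simp only: gbinomial_trinomial_revision [OF assms] one_minus_X_powr_nth mult_1_left mult.assoc)
qed

text \<open>
  With \<open>y = x / (1 - x)\<close> and the coefficients \<open>b\<^sub>i\<close> of \<open>(1 - x)\<^bsup>-a\<^esup>\<close>, the binomial expansion of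
  \<open>(e\<^sub>\<lambda>(t) - 1)\<^sup>i\<close> turns the left side into a double sum over \<open>j \<le> i\<close>. Revision splits off
  \<open>b\<^sub>j (j)\<^sub>m\<close>, and what remains for fixed \<open>j\<close> is \<open>y\<^sup>j (1 + y)\<^bsup>-a-j\<^esup>\<close>. Since
  \<open>1 + y = (1 - x)\<^bsup>-1\<^esup>\<close> and \<open>y (1 - x) = x\<close>, this equals \<open>(1 - x)\<^sup>a x\<^sup>j\<close>.
\<close>

lemma poly_at_ratio_degen_fubini:
  assumes "l \<noteq> 0"
  shows "poly_at_ratio (degen_fubini a l m)
    = one_minus_X_powr a
        * Abs_fps (\<lambda>j. fps_nth (one_minus_X_powr (- a)) j * degen_ffact l (of_nat j) m)"
proof (rule fps_ext)
  fix k
  define b where "b = fps_nth (one_minus_X_powr (- a))"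
  define d where "d j = degen_ffact l (of_nat j) m" for j
  define c where "c j = fps_binomial (- a - of_nat j)" for j :: nat
  have inner: "(\<Sum>i=j..k. fps_nth (c j) (i - j) * fps_nth (ratio ^ i) k)
      = fps_nth (one_minus_X_powr a * fps_X ^ j) k" for j
  proof -
    have "(\<Sum>i=j..k. fps_nth (c j) (i - j) * fps_nth (ratio ^ i) k)
        = (\<Sum>i\<le>k. if i < j then 0 else fps_nth (c j) (i - j) * fps_nth (ratio ^ i) k)"
      by (rule sum.mono_neutral_cong_left) auto
    also have "\<dots> = fps_nth (fps_X ^ j * c j oo ratio) k"
      by (simp add: fps_compose_nth fps_X_power_mult_nth atLeast0AtMost if_distrib
          [of "\<lambda>z. z * _"] cong: if_cong)
    also have "fps_X ^ j * c j oo ratio = ratio ^ j * one_minus_X_powr (a + of_nat j)"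
      unfolding c_def
      by (simp add: fps_compose_mult_distrib ratio_nth_0 fps_binomial_compose_ratio add.commute
          flip: fps_compose_power)
    also have "\<dots> = one_minus_X_powr a * (ratio * (1 - fps_X)) ^ j"
      by (simp only: one_minus_X_powr_add one_minus_X_powr_of_nat power_mult_distrib mult_ac)
    finally show ?thesis
      by (simp only: ratio_mult_one_minus_X)
  qed
  have revision: "b i * (of_nat (i choose j) * (-1) ^ (i - j)) = b j * fps_nth (c j) (i - j)"
    if "j \<le> i" for i j
    using one_minus_X_powr_nth_revision [OF that, of "- a"] by (simp only: b_def c_def fps_binomial_nth)
  have "fps_nth (poly_at_ratio (degen_fubini a l m)) k
      = (\<Sum>i\<le>k. b i * (fact m * fps_nth ((degen_exp l - 1) ^ i) m) * fps_nth (ratio ^ i) k)"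
    by (simp add: degen_fubini_altdef poly_at_ratio_smult poly_at_ratio_eval_fubini_arg_nth
        sum_distrib_left mult_ac b_def)
  also have "\<dots> = (\<Sum>i\<le>k. \<Sum>j\<le>i. b i * (of_nat (i choose j) * (-1) ^ (i - j)) * d j
      * fps_nth (ratio ^ i) k)"
    by (simp add: degen_exp_minus_one_power_nth [OF assms] sum_distrib_left sum_distrib_right
        mult_ac d_def)
  also have "\<dots> = (\<Sum>i\<le>k. \<Sum>j\<le>i. b j * d j * (fps_nth (c j) (i - j) * fps_nth (ratio ^ i) k))"
    by (intro sum.cong refl, subst revision) (simp_all only: atMost_iff mult_ac)
  also have "\<dots> = (\<Sum>j\<le>k. \<Sum>i=j..k. b j * d j * (fps_nth (c j) (i - j) * fps_nth (ratio ^ i) k))"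
  proof -
    have rows: "{j. j \<in> {..k} \<and> j \<le> i} = {..i}" if "i \<in> {..k}" for i
      using that by auto
    have columns: "{i. i \<in> {..k} \<and> j \<le> i} = {j..k}" for j
      by auto
    show ?thesis
      using sum.swap_restrict [of "{..k}" "{..k}"
          "\<lambda>i j. b j * d j * (fps_nth (c j) (i - j) * fps_nth (ratio ^ i) k)" "\<lambda>i j. j \<le> i"]
      by (simp only: rows columns finite_atMost cong: sum.cong)
  qed
  also have "\<dots> = (\<Sum>j\<le>k. b j * d j * fps_nth (one_minus_X_powr a * fps_X ^ j) k)"
    by (intro sum.cong refl) (simp add: inner flip: sum_distrib_left)
  also have "\<dots> = (\<Sum>j\<le>k. (b j * d j) * fps_nth (one_minus_X_powr a) (k - j))"
    by (intro sum.cong refl) (simp add: fps_X_power_mult_right_nth)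
  also have "\<dots> = fps_nth (one_minus_X_powr a * Abs_fps (\<lambda>j. b j * d j)) k"
    by (subst mult.commute) (simp add: fps_mult_nth atLeast0AtMost)
  finally show "fps_nth (poly_at_ratio (degen_fubini a l m)) k
      = fps_nth (one_minus_X_powr a
          * Abs_fps (\<lambda>j. fps_nth (one_minus_X_powr (- a)) j * degen_ffact l (of_nat j) m)) k"
    by (simp add: b_def d_def)
qed

section \<open>Coefficientwise sums\<close>

text \<open>
  Convergence and value in one predicate: products with a fixed series preserve it because each
  coefficient of the product involves only finitely many coefficients of the factors.
\<close>

definition fps_coeff_sums :: "(nat \<Rightarrow> complex fps) \<Rightarrow> complex fps \<Rightarrow> bool" where
  "fps_coeff_sums g s \<longleftrightarrow> (\<forall>k. (\<lambda>m. fps_nth (g m) k) sums fps_nth s k)"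

lemma fps_coeff_sums_imp:
  assumes "fps_coeff_sums g s"
  shows "fps_coeff_summable g" and "fps_coeff_suminf g = s"
  using assms
  by (auto simp: fps_coeff_sums_def fps_coeff_summable_def fps_coeff_suminf_def fps_eq_iff
      sums_iff)

lemma fps_coeff_sums_mult:
  assumes "fps_coeff_sums g s"
  shows "fps_coeff_sums (\<lambda>m. c * g m) (c * s)"
  using assms unfolding fps_coeff_sums_def fps_mult_nth by (intro allI sums_sum sums_mult) auto

lemma fps_coeff_sums_diff:
  assumes "fps_coeff_sums g s" "fps_coeff_sums h t"
  shows "fps_coeff_sums (\<lambda>m. g m - h m) (s - t)"
  using assms unfolding fps_coeff_sums_def by (auto intro: sums_diff)

lemma fps_coeff_sums_degen_fubini:
  fixes l :: complex
  assumes "l \<noteq> 0"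
    and "\<And>n::nat. (\<lambda>m. fps_nth f m * degen_ffact l (of_nat n) m) sums S n"
  shows "fps_coeff_sums (\<lambda>m. fps_const (fps_nth f m) * poly_at_ratio (degen_fubini a l m))
    (one_minus_X_powr a * Abs_fps (\<lambda>n. fps_nth (one_minus_X_powr (- a)) n * S n))"
proof -
  have "fps_coeff_sums
      (\<lambda>m. Abs_fps (\<lambda>n. fps_nth (one_minus_X_powr (- a)) n
        * (fps_nth f m * degen_ffact l (of_nat n) m)))
      (Abs_fps (\<lambda>n. fps_nth (one_minus_X_powr (- a)) n * S n))"
    unfolding fps_coeff_sums_def by (auto intro: sums_mult assms(2))
  from fps_coeff_sums_mult [OF this, of "one_minus_X_powr a"]
  have "fps_coeff_sums
      (\<lambda>m. one_minus_X_powr a * Abs_fps (\<lambda>n. fps_nth (one_minus_X_powr (- a)) n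
        * (fps_nth f m * degen_ffact l (of_nat n) m)))
      (one_minus_X_powr a * Abs_fps (\<lambda>n. fps_nth (one_minus_X_powr (- a)) n * S n))" .
  moreover have "one_minus_X_powr a * Abs_fps (\<lambda>n. fps_nth (one_minus_X_powr (- a)) n
        * (fps_nth f m * degen_ffact l (of_nat n) m))
      = fps_const (fps_nth f m) * poly_at_ratio (degen_fubini a l m)" for m
  proof -
    have "Abs_fps (\<lambda>n. fps_nth (one_minus_X_powr (- a)) n
          * (fps_nth f m * degen_ffact l (of_nat n) m))
        = fps_const (fps_nth f m)
          * Abs_fps (\<lambda>n. fps_nth (one_minus_X_powr (- a)) n * degen_ffact l (of_nat n) m)"
      by (rule fps_ext) simp
    then show ?thesis
      by (simp only: poly_at_ratio_degen_fubini [OF assms(1)] mult_ac)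
  qed
  ultimately show ?thesis
    by simp
qed

theorem theorem8:
  fixes lam :: real and f :: "complex fps"
  assumes "lam \<noteq> 0"
    and "\<And>n::nat. summable (\<lambda>m. fps_nth f m * degen_ffact (complex_of_real lam) (of_nat n) m)"
  shows
    "fps_coeff_summable (\<lambda>m. fps_const (fps_nth f m) * poly_at_ratio (harmonic_fubini (complex_of_real lam) m)) \<and>
     fps_coeff_summable (\<lambda>m. fps_const (fps_nth f m) * poly_at_ratio (degen_fubini (complex_of_real (1 - lam)) (complex_of_real lam) m)) \<and>
     Abs_fps (\<lambda>n. degen_harmonic (complex_of_real lam) n * (\<Sum>m. fps_nth f m * degen_ffact (complex_of_real lam) (of_nat n) m)) =
       1 / (1 - fps_X) *
         fps_coeff_suminf (\<lambda>m. fps_const (fps_nth f m) * poly_at_ratio (harmonic_fubini (complex_of_real lam) m))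
       - (degen_log (complex_of_real lam) oo (- fps_X)) / (1 - fps_X) *
         fps_coeff_suminf (\<lambda>m. fps_const (fps_nth f m) * poly_at_ratio (degen_fubini (complex_of_real (1 - lam)) (complex_of_real lam) m))"
proof -
  define l where "l = complex_of_real lam"
  define S where "S n = (\<Sum>m. fps_nth f m * degen_ffact l (of_nat n) m)" for n :: nat
  define A where "A a = Abs_fps (\<lambda>n. fps_nth (one_minus_X_powr (- a)) n * S n)" for a
  define R where "R = inverse (1 - fps_X :: complex fps)"
  define F where "F = one_minus_X_powr (1 - l) * A (1 - l)"
  define HF where "HF = fps_const (1 / l) * ((1 - fps_X) * A 1 - F)"
  have l: "l \<noteq> 0"
    using assms(1) by (simp add: l_def)
  have R: "R * (1 - fps_X) = 1"
    unfolding R_def by (rule inverse_mult_eq_1) simp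
  have S: "(\<lambda>m. fps_nth f m * degen_ffact l (of_nat n) m) sums S n" for n :: nat
    using assms(2) by (simp add: S_def l_def summable_sums)
  have sums_fubini:
    "fps_coeff_sums (\<lambda>m. fps_const (fps_nth f m) * poly_at_ratio (degen_fubini a l m))
       (one_minus_X_powr a * A a)" for a
    unfolding A_def by (rule fps_coeff_sums_degen_fubini [OF l S])
  have F: "fps_coeff_sums
      (\<lambda>m. fps_const (fps_nth f m) * poly_at_ratio (degen_fubini (1 - l) l m)) F"
    unfolding F_def by (rule sums_fubini)
  have one: "one_minus_X_powr 1 = (1 - fps_X :: complex fps)"
    using one_minus_X_powr_of_nat [of 1, where ?'a = complex] by simp
  have "fps_coeff_sums
      (\<lambda>m. fps_const (1 / l) * (fps_const (fps_nth f m) * poly_at_ratio (degen_fubini 1 l m)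
        - fps_const (fps_nth f m) * poly_at_ratio (degen_fubini (1 - l) l m))) HF"
    unfolding HF_def
    by (intro fps_coeff_sums_mult fps_coeff_sums_diff F sums_fubini [of 1, unfolded one])
  moreover have "fps_const (1 / l)
        * (fps_const (fps_nth f m) * poly_at_ratio (degen_fubini 1 l m)
          - fps_const (fps_nth f m) * poly_at_ratio (degen_fubini (1 - l) l m))
      = fps_const (fps_nth f m) * poly_at_ratio (harmonic_fubini l m)" for m
    by (simp only: harmonic_fubini_eq poly_at_ratio_smult poly_at_ratio_diff)
      (simp only: algebra_simps)
  ultimately have HF: "fps_coeff_sums
      (\<lambda>m. fps_const (fps_nth f m) * poly_at_ratio (harmonic_fubini l m)) HF"
    by simp
  \<comment> \<open>The exponents \<open>\<lambda>\<close>, \<open>-1\<close> and \<open>1 - \<lambda>\<close> add up to \<open>0\<close>: this is why the order \<open>1 - \<lambda>\<close> appears.\<close>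
  have "one_minus_X_powr l * R * F = one_minus_X_powr (l + (-1) + (1 - l)) * A (1 - l)"
    by (simp only: F_def R_def one_minus_X_powr_add one_minus_X_powr_minus_one mult_ac)
  then have F_cancel: "one_minus_X_powr l * R * F = A (1 - l)"
    by (simp add: one_minus_X_powr_0)
  have "R * HF - (degen_log l oo (- fps_X)) * R * F
      = fps_const (1 / l) * ((R * (1 - fps_X)) * A 1 - R * F)
        - fps_const (1 / l) * (one_minus_X_powr l * R * F - R * F)"
    unfolding HF_def degen_log_compose_uminus_X by (simp only: algebra_simps mult_1_left)
  also have "\<dots> = fps_const (1 / l) * (A 1 - A (1 - l))"
    unfolding R F_cancel by (simp add: algebra_simps)
  also have "\<dots> = Abs_fps (\<lambda>n. degen_harmonic l n * S n)"
    by (rule fps_ext) (simp add: A_def degen_harmonic_eq algebra_simps diff_divide_distrib)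
  finally have "Abs_fps (\<lambda>n. degen_harmonic l n * S n)
      = R * HF - (degen_log l oo (- fps_X)) * R * F" ..
  moreover have "1 / (1 - fps_X) = R" "(degen_log l oo (- fps_X)) / (1 - fps_X)
      = (degen_log l oo (- fps_X)) * R"
    by (simp_all add: R_def fps_divide_unit)
  ultimately show ?thesis
    using fps_coeff_sums_imp [OF HF] fps_coeff_sums_imp [OF F] by (simp add: l_def S_def)
qed

end
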